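(* Let $A\subset\mathcal{H}$ be an $R$-proximally smooth set containing distinct points $a$ and $b$ with $|a-b|<2R$, and let $T=\{t_i\}_0^n$ with $0=t_0<\dots<t_n=1$ be a partition of $[0,1]$. Then $$\rho_A^2(a,b)\ \ge\ \mathcal{L}(A,a,b,T)\ \ge\ \frac{\rho_A^2(a,b)}{k_T^2},\qquad\text{where}\quad k_T=\frac{\arcsin\left(\frac{\pi}{2}\sqrt{\operatorname{mesh}T}\right)}{\frac{\pi}{2}\sqrt{\operatorname{mesh}T}}.$$
   Context: $\mathcal{H}$ is a Hilbert space of dimension at least two with norm $|\cdot|$, and $R>0$ is fixed. $\operatorname{dist}(x,A)=\inf_{y\in A}|x-y|$. A set $A$ is $R$-proximally smooth if it is closed and $x\mapsto \operatorname{dist}(x,A)$ is continuously differentiable on $\{x: 0<\operatorname{dist}(x,A)<R\}$. $\operatorname{mesh}T=\max_{1\le i\le n}(t_i-t_{i-1})$. $\rho_A(a,b)$ is the infimum of the lengths (total variations) of all continuous curves in $A$ connecting $a$ and $b$ ($+\infty$ if there is no rectifiable one). The discrete energy functional is $$\mathcal{L}(A,a,b,T)=\inf\ \sum_{i=1}^n\frac{|x_i-x_{i-1}|^2}{t_i-t_{i-1}},$$ the infimum over all finite sequences $\{x_i\}_0^n\subset A$ with $x_0=a$ and $x_n=b$.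
   Formalization: The lower bound is stated only for partitions with (π/2)·sqrt(mesh T) ≤ 1, since otherwise (e.g. n = 1) the arcsine, and hence k_T, is undefined; the upper bound is stated for every partition. *)

theory Defs
  imports "HOL-Analysis.Analysis"
begin

text \<open>The library's \<^const>\<open>C1_differentiable_on\<close> only covers functions on the real line, so
  continuous differentiability of the distance function is expressed through its Frechet
  derivative being continuous in the operator norm.\<close>

definition proximally_smooth :: "real \<Rightarrow> 'a::real_normed_vector set \<Rightarrow> bool" where
  "proximally_smooth R A \<longleftrightarrow> closed A \<and>
     (\<exists>D :: 'a \<Rightarrow> ('a \<Rightarrow>\<^sub>L real).
        (\<forall>x \<in> {x. 0 < infdist x A \<and> infdist x A < R}.
           ((\<lambda>y. infdist y A) has_derivative blinfun_apply (D x)) (at x)) \<and>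
        continuous_on {x. 0 < infdist x A \<and> infdist x A < R} D)"

text \<open>A partition of the unit interval consists of the values \<open>t 0, \<dots>, t n\<close>; the values of \<open>t\<close>
  beyond \<open>n\<close> are irrelevant. The endpoint conditions force \<open>n > 0\<close>.\<close>

definition is_partition :: "nat \<Rightarrow> (nat \<Rightarrow> real) \<Rightarrow> bool" where
  "is_partition n t \<longleftrightarrow> t 0 = 0 \<and> t n = 1 \<and> (\<forall>i\<in>{1..n}. t (i - 1) < t i)"

definition mesh :: "nat \<Rightarrow> (nat \<Rightarrow> real) \<Rightarrow> real" where
  "mesh n t = Max ((\<lambda>i. t i - t (i - 1)) ` {1..n})"

definition curve_length :: "(real \<Rightarrow> 'a::real_normed_vector) \<Rightarrow> ennreal" where
  "curve_length g =
     (SUP (n, t) \<in> {(n, t). is_partition n t}.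
        ennreal (\<Sum>i=1..n. norm (g (t i) - g (t (i - 1)))))"

text \<open>Curves are parametrized over the unit interval. The infimum over the empty set is
  \<open>\<infinity>\<close>.\<close>

definition intrinsic_dist :: "'a::real_normed_vector set \<Rightarrow> 'a \<Rightarrow> 'a \<Rightarrow> ennreal" where
  "intrinsic_dist A a b =
     (INF g \<in> {g. path g \<and> path_image g \<subseteq> A \<and> pathstart g = a \<and> pathfinish g = b}.
        curve_length g)"

definition discrete_energy ::
  "'a::real_normed_vector set \<Rightarrow> 'a \<Rightarrow> 'a \<Rightarrow> nat \<Rightarrow> (nat \<Rightarrow> real) \<Rightarrow> ennreal" where
  "discrete_energy A a b n t =
     (INF x \<in> {x :: nat \<Rightarrow> 'a. (\<forall>i\<le>n. x i \<in> A) \<and> x 0 = a \<and> x n = b}.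
        ennreal (\<Sum>i=1..n. (norm (x i - x (i - 1)))\<^sup>2 / (t i - t (i - 1))))"

text \<open>This is meaningful only when the argument of \<^const>\<open>arcsin\<close> is at most \<open>1\<close>, that is, when
  the mesh is at most \<open>4 / pi\<^sup>2\<close>; beyond that, \<^const>\<open>arcsin\<close> has an unspecified value.\<close>

definition mesh_const :: "nat \<Rightarrow> (nat \<Rightarrow> real) \<Rightarrow> real" where
  "mesh_const n t = arcsin (pi / 2 * sqrt (mesh n t)) / (pi / 2 * sqrt (mesh n t))"

end

theory Submission
  imports Defs
begin

text \<open>Differentiability of the distance function in the tube around \<open>A\<close> yields nearest points and
  shows that each normal ray stays normal up to distance \<open>R\<close>: a ball of radius \<open>R\<close> touches \<open>A\<close> from
  outside at the nearest point. Hence, if \<open>\<bar>x - y\<bar> \<le> 2 R sin \<theta>\<close>, the projection \<open>p\<close> of the midpoint satisfies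
  \<open>\<bar>x - p\<bar>, \<bar>p - y\<bar> \<le> 2 R sin (\<theta> / 2)\<close>, as on a circle of radius \<open>R\<close>. Iterating this dyadically gives
  a curve in \<open>A\<close> of length at most \<open>2 R \<theta>\<close>, that is, \<open>\<rho> x y \<le> 2 R arcsin (\<bar>x - y\<bar> / 2 R)\<close>.

  For the lower bound, a sequence of energy at least \<open>(\<pi> R)\<^sup>2\<close> is harmless since \<open>\<rho> a b \<le> \<pi> R\<close>.
  Otherwise each step has length less than \<open>\<pi> R sqrt (mesh T)\<close>, so that \<open>\<rho>\<close> exceeds it at most by the
  factor \<open>k\<^sub>T\<close>, as \<open>arcsin u / u\<close> is increasing, and the Cauchy-Schwarz inequality concludes. For the
  upper bound, a curve is cut into pieces of length proportional to the \<open>t i - t (i - 1)\<close>.\<close>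

subsection \<open>Normal rays of the distance function\<close>

text \<open>The distance function is 1-Lipschitz, so its difference quotients in direction
  \<open>h\<close> are at most \<open>norm h\<close>. A unit vector \<open>e\<close> with
  \<open>D e = 1\<close> is thus a direction of steepest ascent.\<close>

lemma has_derivative_infdist_bound:
  fixes A :: "'a::real_normed_vector set"
  assumes D: "((\<lambda>y. infdist y A) has_derivative D) (at m)"
  shows "\<bar>D h\<bar> \<le> norm h"
proof -
  interpret bounded_linear D using D by (rule has_derivative_bounded_linear)
  have "((\<lambda>t. infdist (m + t *\<^sub>R h) A) has_derivative (\<lambda>t. D (t *\<^sub>R h))) (at 0)"
    by (rule has_derivative_compose[of "\<lambda>t. m + t *\<^sub>R h", where g = "\<lambda>y. infdist y A"])
       (auto intro!: derivative_eq_intros D)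
  then have "((\<lambda>t. infdist (m + t *\<^sub>R h) A) has_real_derivative D h) (at 0)"
    by (simp add: has_field_derivative_def scaleR mult_commute_abs)
  then have "((\<lambda>t. (infdist (m + t *\<^sub>R h) A - infdist m A) / t) \<longlongrightarrow> D h) (at 0)"
    by (simp add: DERIV_def)
  then have "((\<lambda>t. \<bar>(infdist (m + t *\<^sub>R h) A - infdist m A) / t\<bar>) \<longlongrightarrow> \<bar>D h\<bar>) (at 0)"
    by (rule tendsto_rabs)
  moreover have "\<bar>(infdist (m + t *\<^sub>R h) A - infdist m A) / t\<bar> \<le> norm h" if "t \<noteq> 0" for t
    using infdist_triangle_abs[of "m + t *\<^sub>R h" A m] that
    by (simp add: dist_norm abs_divide divide_le_eq mult.commute)
  then have "\<forall>\<^sub>F t in at 0. \<bar>(infdist (m + t *\<^sub>R h) A - infdist m A) / t\<bar> \<le> norm h"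
    by (auto simp: eventually_at_filter)
  ultimately show ?thesis
    by (intro tendsto_upperbound[where F = "at (0::real)"]) auto
qed

text \<open>By Frechet differentiability, the directions \<open>u n\<close> from a minimizing sequence to \<open>m\<close> satisfy
  \<open>D (u n) \<rightarrow> 1\<close>. Since \<open>D\<close> has norm at most one, \<open>\<bar>u n + u k\<bar>\<close> is close to \<open>2\<close>, and the parallelogram
  law makes \<open>u\<close> a Cauchy sequence: the nearest point exists without any compactness.\<close>

lemma infdist_nearest_direction:
  fixes A :: "'a::{real_inner, complete_space} set"
  assumes "closed A" "A \<noteq> {}" and pos: "0 < infdist m A"
    and D: "((\<lambda>y. infdist y A) has_derivative D) (at m)"
  obtains e where "norm e = 1" "D e = 1" "m - infdist m A *\<^sub>R e \<in> A"
proof -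
  define d where "d = infdist m A"
  interpret bounded_linear D using D by (rule has_derivative_bounded_linear)
  have Dle: "D h \<le> norm h" for h
    using has_derivative_infdist_bound[OF D, of h] by simp
  \<comment> \<open>Moving by \<open>t\<close> from \<open>m\<close> towards an almost nearest point
    \<open>y\<close> lowers the distance to \<open>A\<close> by almost \<open>t\<close>, and the
    derivative must account for this loss.\<close>
  have near: "\<exists>\<eta>>0. \<forall>y\<in>A. dist m y < d + \<eta> \<longrightarrow> D ((1 / dist m y) *\<^sub>R (m - y)) \<ge> 1 - \<epsilon>"
    if "\<epsilon> > 0" for \<epsilon>
  proof -
    from D that obtain \<delta> where "\<delta> > 0" and \<delta>:
      "\<And>y. norm (y - m) < \<delta> \<Longrightarrow>
         norm (infdist y A - infdist m A - D (y - m)) \<le> \<epsilon>/2 * norm (y - m)"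
      unfolding has_derivative_at_alt by (metis half_gt_zero)
    \<comment> \<open>\<open>t < \<delta>\<close> keeps the step where the linearization is valid,
      \<open>t \<le> d\<close> keeps it from overshooting \<open>y\<close>. Near-minimality and
      linearization may each cost \<open>\<epsilon> / 2 * t\<close>.\<close>
    define t where "t = min (\<delta>/2) d"
    have t: "0 < t" "t < \<delta>" "t \<le> d"
      using \<open>\<delta> > 0\<close> pos by (auto simp: t_def d_def)
    show ?thesis
    proof (intro exI[of _ "\<epsilon> / 2 * t"] conjI ballI impI)
      show "0 < \<epsilon> / 2 * t" using that t by simp
    next
      fix y assume y: "y \<in> A" "dist m y < d + \<epsilon> / 2 * t"
      define r u where "r = dist m y" and "u = (1 / r) *\<^sub>R (m - y)"
      have "d \<le> r" unfolding d_def r_def by (rule infdist_le[OF y(1)])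
      then have r: "r > 0" "t \<le> r" using t by auto
      have "norm u = 1" using r by (simp add: u_def r_def dist_norm)
      have "infdist (m - t *\<^sub>R u) A \<le> dist (m - t *\<^sub>R u) y"
        by (rule infdist_le[OF y(1)])
      also have "m - y = r *\<^sub>R u" using r by (simp add: u_def)
      then have "m - t *\<^sub>R u - y = (r - t) *\<^sub>R u" by (simp add: algebra_simps)
      then have "dist (m - t *\<^sub>R u) y = r - t"
        using r \<open>norm u = 1\<close> by (simp add: dist_norm)
      finally have "infdist (m - t *\<^sub>R u) A \<le> r - t" .
      moreover have "\<bar>infdist (m - t *\<^sub>R u) A - d + t * D u\<bar> \<le> \<epsilon>/2 * t"
        using \<delta>[of "m - t *\<^sub>R u"] t \<open>norm u = 1\<close> by (simp add: d_def linear_neg[OF linear_axioms] scaleR)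
      ultimately have "d - t * D u - \<epsilon>/2 * t \<le> r - t" by linarith
      then have "t * (1 - \<epsilon>) \<le> t * D u" using y(2) by (simp add: r_def algebra_simps)
      then show "1 - \<epsilon> \<le> D ((1 / dist m y) *\<^sub>R (m - y))"
        using t by (simp add: u_def r_def)
    qed
  qed
  have "\<exists>y\<in>A. dist m y < d + 1 / real (Suc n)" for n
    using cInf_lessD[of "dist m ` A" "d + 1 / real (Suc n)"] assms(2)
    by (auto simp: d_def infdist_notempty)
  then obtain y where y: "\<And>n. y n \<in> A" "\<And>n. dist m (y n) < d + 1 / real (Suc n)" by metis
  have dle: "d \<le> dist m (y n)" for n unfolding d_def by (rule infdist_le[OF y(1)])
  define u where "u n = (1 / dist m (y n)) *\<^sub>R (m - y n)" for n
  have dpos: "0 < dist m (y n)" for n using pos dle[of n] unfolding d_def by (rule less_le_trans)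
  have nu: "norm (u n) = 1" for n
    using dpos[of n] by (simp add: u_def dist_norm)
  have lim0: "(\<lambda>n. d + 1 / real (Suc n)) \<longlonglongrightarrow> d"
    using tendsto_add[OF tendsto_const LIMSEQ_inverse_real_of_nat, of d] by (simp add: divide_inverse)
  have limd: "(\<lambda>n. dist m (y n)) \<longlonglongrightarrow> d"
    by (rule tendsto_sandwich[OF _ _ tendsto_const lim0]) (use dle less_imp_le[OF y(2)] in \<open>auto intro!: always_eventually simp del: of_nat_Suc\<close>)
  have Du: "\<exists>N. \<forall>n\<ge>N. D (u n) \<ge> 1 - \<epsilon>" if "\<epsilon> > 0" for \<epsilon>
  proof -
    from near[OF that] obtain \<eta> where \<eta>: "\<eta> > 0"
      "\<And>z. z \<in> A \<Longrightarrow> dist m z < d + \<eta> \<Longrightarrow> D ((1 / dist m z) *\<^sub>R (m - z)) \<ge> 1 - \<epsilon>" by blast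
    have "\<forall>\<^sub>F n in sequentially. dist m (y n) < d + \<eta>"
      using limd \<eta>(1) by (intro order_tendstoD(2)) auto
    then show ?thesis using \<eta>(2) y(1) unfolding eventually_sequentially u_def by blast
  qed
  have "Cauchy u"
  proof (rule metric_CauchyI)
    fix \<epsilon> :: real assume "\<epsilon> > 0"
    \<comment> \<open>The parallelogram law will bound the square of \<open>norm (u n - u k)\<close>
      by \<open>8 * \<kappa>\<close>; \<open>\<kappa> \<le> 1\<close> keeps
      \<open>1 - \<kappa>\<close> nonnegative for squaring.\<close>
    define \<kappa> where "\<kappa> = min 1 (\<epsilon>\<^sup>2 / 16)"
    have \<kappa>: "0 < \<kappa>" "\<kappa> \<le> 1" "8 * \<kappa> < \<epsilon>\<^sup>2" using \<open>\<epsilon> > 0\<close> by (auto simp: \<kappa>_def min_def)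
    from Du[OF \<kappa>(1)] obtain N where N: "\<And>n. n \<ge> N \<Longrightarrow> D (u n) \<ge> 1 - \<kappa>" by blast
    have "dist (u n) (u k) < \<epsilon>" if "n \<ge> N" "k \<ge> N" for n k
    proof -
      have "2 * (1 - \<kappa>) \<le> D (u n + u k)" using N[OF that(1)] N[OF that(2)] by (simp add: add)
      also have "\<dots> \<le> norm (u n + u k)" by (rule Dle)
      finally have "(2 * (1 - \<kappa>))\<^sup>2 \<le> (norm (u n + u k))\<^sup>2" using \<kappa> by (intro power_mono) auto
      moreover have "(norm (u n + u k))\<^sup>2 + (norm (u n - u k))\<^sup>2 = 2 * (norm (u n))\<^sup>2 + 2 * (norm (u k))\<^sup>2"
        by (simp add: power2_norm_eq_inner inner_simps inner_commute)
      ultimately have "(norm (u n - u k))\<^sup>2 \<le> 4 - (2 * (1 - \<kappa>))\<^sup>2" by (simp add: nu)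
      also have "\<dots> \<le> 8 * \<kappa>" by (simp add: power2_eq_square algebra_simps)
      finally have "(norm (u n - u k))\<^sup>2 < \<epsilon>\<^sup>2" using \<kappa> by simp
      then show ?thesis using \<open>\<epsilon> > 0\<close> by (simp add: dist_norm power_less_imp_less_base)
    qed
    then show "\<exists>M. \<forall>m\<ge>M. \<forall>n\<ge>M. dist (u m) (u n) < \<epsilon>" by blast
  qed
  then obtain e where e: "u \<longlonglongrightarrow> e" using Cauchy_convergent convergentD by blast
  have ne: "norm e = 1" using tendsto_norm[OF e] by (simp add: nu LIMSEQ_const_iff)
  have "1 \<le> D e"
  proof (rule field_le_epsilon)
    fix \<epsilon> :: real assume "\<epsilon> > 0"
    have "(\<lambda>n. D (u n)) \<longlonglongrightarrow> D e" by (rule tendsto[OF e])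
    then have "1 - \<epsilon> \<le> D e" by (rule LIMSEQ_le_const) (use Du[OF \<open>\<epsilon> > 0\<close>] in blast)
    then show "1 \<le> D e + \<epsilon>" by simp
  qed
  then have "D e = 1" using Dle[of e] ne by simp
  have "(\<lambda>n. m - dist m (y n) *\<^sub>R u n) \<longlonglongrightarrow> m - d *\<^sub>R e"
    by (intro tendsto_intros limd e)
  moreover have "m - dist m (y n) *\<^sub>R u n = y n" for n using dpos[of n] by (simp add: u_def)
  ultimately have "y \<longlonglongrightarrow> m - d *\<^sub>R e" by simp
  then have "m - d *\<^sub>R e \<in> A" using closed_sequentially[OF assms(1)] y(1) by blast
  then show ?thesis using that ne \<open>D e = 1\<close> by (simp add: d_def)
qed

section \<open>Ekeland's variational principle and the extension of normal rays\<close>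

text \<open>The relation \<open>z' \<in> G z\<close>, that \<open>f\<close> gains at least
  \<open>c\<close> per unit of distance, is transitive. Greedy choices along it have increasing
  bounded values, hence form a Cauchy sequence, and its limit admits no further gain.\<close>

lemma ekeland_maximum:
  fixes f :: "'a::complete_space \<Rightarrow> real"
  assumes "closed S" "m \<in> S" "continuous_on S f" "c > 0" "\<And>z. z \<in> S \<Longrightarrow> f z \<le> B"
  obtains z where "z \<in> S" "c * dist z m \<le> f z - f m"
    "\<And>z'. z' \<in> S \<Longrightarrow> z' \<noteq> z \<Longrightarrow> f z' - f z < c * dist z' z"
proof -
  define G where "G z = {z' \<in> S. c * dist z' z \<le> f z' - f z}" for z
  have G_trans: "w \<in> G z" if "w \<in> G z'" "z' \<in> G z" for w z' z
  proof -
    have "c * dist w z \<le> c * dist w z' + c * dist z' z"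
      using \<open>c > 0\<close> dist_triangle[of w z z'] by (simp flip: distrib_left)
    then show ?thesis using that by (auto simp: G_def)
  qed
  \<comment> \<open>The inequality says that \<open>z'\<close> realizes at least half of the gain
    that any \<open>w\<close> in \<open>G z\<close> offers over \<open>z\<close>. Once the values
    converge, the remaining gain therefore tends to 0.\<close>
  have step: "\<exists>z'\<in>G z. \<forall>w\<in>G z. f w \<le> 2 * f z' - f z" if "z \<in> S" for z
  proof -
    define \<sigma> where "\<sigma> = (SUP w\<in>G z. f w)"
    have bdd: "bdd_above (f ` G z)" using assms(5) by (auto simp: G_def bdd_above_def)
    have zG: "z \<in> G z" using that by (simp add: G_def)
    have le: "f w \<le> \<sigma>" if "w \<in> G z" for w unfolding \<sigma>_def by (rule cSUP_upper[OF that bdd])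
    show ?thesis
    proof (cases "\<sigma> = f z")
      case True
      then have "f w \<le> 2 * f z - f z" if "w \<in> G z" for w using le[OF that] by simp
      then show ?thesis using zG by blast
    next
      case False
      then have "(\<sigma> + f z) / 2 < \<sigma>" using le[OF zG] by simp
      then obtain z' where "z' \<in> G z" "(\<sigma> + f z) / 2 < f z'"
        using less_cSUP_iff[OF _ bdd] zG unfolding \<sigma>_def by blast
      moreover from this have "f w \<le> 2 * f z' - f z" if "w \<in> G z" for w using le[OF that] by simp
      ultimately show ?thesis by blast
    qed
  qed
  then obtain h where h: "\<And>z. z \<in> S \<Longrightarrow> h z \<in> G z"
    "\<And>z w. z \<in> S \<Longrightarrow> w \<in> G z \<Longrightarrow> f w \<le> 2 * f (h z) - f z" by metis
  define Z where "Z k = (h ^^ k) m" for k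
  have ZS: "Z k \<in> S" for k
    by (induction k) (use assms(2) h(1) in \<open>auto simp: Z_def G_def\<close>)
  have ZSuc: "Z (Suc k) = h (Z k)" for k by (simp add: Z_def)
  have Zle: "Z l \<in> G (Z k)" if "k \<le> l" for k l
    using that
  proof (induction l rule: dec_induct)
    case base then show ?case using ZS by (simp add: G_def)
  next
    case (step l)
    show ?case using G_trans[OF h(1)[OF ZS, of l] step.IH] by (simp add: ZSuc)
  qed
  then have Zd: "c * dist (Z l) (Z k) \<le> f (Z l) - f (Z k)" if "k \<le> l" for k l
    using that by (simp add: G_def)
  have "incseq (\<lambda>k. f (Z k))"
  proof (rule incseq_SucI)
    fix k
    have "0 \<le> c * dist (Z (Suc k)) (Z k)" using \<open>c > 0\<close> by simp
    also have "\<dots> \<le> f (Z (Suc k)) - f (Z k)" by (rule Zd) simp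
    finally show "f (Z k) \<le> f (Z (Suc k))" by simp
  qed
  then obtain \<phi> where \<phi>: "(\<lambda>k. f (Z k)) \<longlonglongrightarrow> \<phi>" "\<And>k. f (Z k) \<le> \<phi>"
    using incseq_convergent[of "\<lambda>k. f (Z k)" B] assms(5)[OF ZS] by blast
  have "Cauchy Z"
  proof (rule CauchyI')
    fix \<epsilon> :: real assume "\<epsilon> > 0"
    then have "\<forall>\<^sub>F k in sequentially. f (Z k) > \<phi> - c * \<epsilon>"
      using \<phi>(1) \<open>c > 0\<close> by (intro order_tendstoD(1)) auto
    then obtain N where N: "\<And>k. k \<ge> N \<Longrightarrow> f (Z k) > \<phi> - c * \<epsilon>"
      by (auto simp: eventually_sequentially)
    have "dist (Z k) (Z l) < \<epsilon>" if "k \<ge> N" "l > k" for k l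
    proof -
      have "c * dist (Z l) (Z k) < c * \<epsilon>" using Zd[of k l] N[OF that(1)] \<phi>(2)[of l] that by simp
      then show ?thesis using \<open>c > 0\<close> by (simp add: dist_commute)
    qed
    then show "\<exists>M. \<forall>m\<ge>M. \<forall>n>m. dist (Z m) (Z n) < \<epsilon>" by blast
  qed
  then obtain z where z: "Z \<longlonglongrightarrow> z" using Cauchy_convergent convergentD by blast
  have "z \<in> S" using closed_sequentially[OF assms(1) ZS z] .
  have fz: "(\<lambda>k. f (Z k)) \<longlonglongrightarrow> f z"
    using assms(3) \<open>z \<in> S\<close> ZS z by (auto simp: continuous_on_sequentially o_def)
  have zG: "z \<in> G (Z k)" for k
  proof -
    have "c * dist z (Z k) \<le> f z - f (Z k)"
      by (rule LIMSEQ_le[of "\<lambda>l. c * dist (Z l) (Z k)" _ "\<lambda>l. f (Z l) - f (Z k)"])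
         (auto intro!: tendsto_intros z fz Zd)
    then show ?thesis using \<open>z \<in> S\<close> by (simp add: G_def)
  qed
  show ?thesis
  proof (rule that[OF \<open>z \<in> S\<close>])
    show "c * dist z m \<le> f z - f m" using zG[of 0] by (simp add: G_def Z_def)
  next
    fix z' assume z': "z' \<in> S" "z' \<noteq> z"
    show "f z' - f z < c * dist z' z"
    proof (rule ccontr)
      assume "\<not> ?thesis"
      then have "z' \<in> G z" using z' by (simp add: G_def)
      then have "f z' \<le> 2 * f (Z (Suc k)) - f (Z k)" for k
        using h(2)[OF ZS G_trans[OF \<open>z' \<in> G z\<close> zG], of k] by (simp add: ZSuc)
      moreover have "(\<lambda>k. 2 * f (Z (Suc k)) - f (Z k)) \<longlonglongrightarrow> 2 * f z - f z"
        using LIMSEQ_Suc[OF fz] fz by (intro tendsto_intros)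
      ultimately have "f z' \<le> 2 * f z - f z" by (intro LIMSEQ_le_const) auto
      moreover have "0 < c * dist z' z" using z' \<open>c > 0\<close> by simp
      ultimately show False using \<open>z' \<in> G z\<close> by (simp add: G_def)
    qed
  qed
qed

text \<open>The ray is found by moving away from \<open>A\<close> at almost unit speed until the distance is \<open>s\<close>. A
  gradient flow need not exist in infinite dimension; Ekeland's principle replaces it, because
  a maximal point at distance less than \<open>s\<close> could still be moved in its own nearest-point direction.\<close>

lemma infdist_normal_ray:
  fixes A :: "'a::{real_inner, complete_space} set"
  assumes "closed A" "A \<noteq> {}"
    and diff: "\<And>x. 0 < infdist x A \<Longrightarrow> infdist x A < R \<Longrightarrow> (\<lambda>y. infdist y A) differentiable (at x)"
    and p: "p \<in> A" "norm e = 1" "0 < d" "infdist (p + d *\<^sub>R e) A = d"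
    and s: "d < s" "s < R"
  shows "infdist (p + s *\<^sub>R e) A = s"
proof (rule antisym)
  show "infdist (p + s *\<^sub>R e) A \<le> s"
    using infdist_le[OF p(1), of "p + s *\<^sub>R e"] p s by (simp add: dist_norm)
next
  define m q where "m = p + d *\<^sub>R e" and "q = s - d"
  have q: "q > 0" using s by (simp add: q_def)
  \<comment> \<open>The slope \<open>1 - \<epsilon>\<close> leaves room for the linearization error
    of the ascent step. As \<epsilon> tends to 0, \<open>z\<close> must have travelled almost
    straight away from \<open>A\<close>.\<close>
  have ex: "\<exists>z. infdist z A = s \<and> (1 - \<epsilon>) * dist z m \<le> q" if \<epsilon>: "0 < \<epsilon>" "\<epsilon> < 1" for \<epsilon>
  proof -
    define S where "S = {z. infdist z A \<le> s}"
    have "closed S" unfolding S_def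
      by (intro closed_Collect_le continuous_intros)
    moreover have "m \<in> S" using s p by (simp add: S_def m_def)
    moreover have "continuous_on S (\<lambda>z. infdist z A)" by (intro continuous_intros)
    ultimately obtain z where z: "z \<in> S" "(1 - \<epsilon>) * dist z m \<le> infdist z A - infdist m A"
      "\<And>z'. z' \<in> S \<Longrightarrow> z' \<noteq> z \<Longrightarrow> infdist z' A - infdist z A < (1 - \<epsilon>) * dist z' z"
      by (rule ekeland_maximum[where c = "1 - \<epsilon>" and B = s]) (use \<epsilon> in \<open>auto simp: S_def\<close>)
    have "0 \<le> (1 - \<epsilon>) * dist z m" using \<epsilon> by simp
    then have zpos: "d \<le> infdist z A" using z(2) p by (simp add: m_def)
    have "infdist z A = s"
    proof (rule ccontr)
      assume "infdist z A \<noteq> s"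
      then have lt: "infdist z A < s" using z(1) by (simp add: S_def)
      then obtain D where D: "((\<lambda>y. infdist y A) has_derivative D) (at z)"
        using diff[of z] zpos p s unfolding differentiable_def by auto
      interpret bounded_linear D using D by (rule has_derivative_bounded_linear)
      obtain v where v: "norm v = 1" "D v = 1"
        using infdist_nearest_direction[OF assms(1,2) _ D] zpos p by auto
      from D \<epsilon> obtain \<delta> where "\<delta> > 0" and \<delta>:
        "\<And>y. norm (y - z) < \<delta> \<Longrightarrow> norm (infdist y A - infdist z A - D (y - z)) \<le> \<epsilon> * norm (y - z)"
        unfolding has_derivative_at_alt by metis
      define h where "h = min (\<delta>/2) (s - infdist z A)"
      have h: "0 < h" "h < \<delta>" "h \<le> s - infdist z A" using \<open>\<delta> > 0\<close> lt by (auto simp: h_def)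
      define z' where "z' = z + h *\<^sub>R v"
      have dz: "dist z' z = h" "z' \<noteq> z" using h v by (auto simp: z'_def dist_norm)
      have "z' \<in> S" using infdist_triangle[of z' A z] dz h by (simp add: S_def)
      moreover have "(1 - \<epsilon>) * dist z' z \<le> infdist z' A - infdist z A"
        using \<delta>[of z'] h v by (simp add: z'_def dist_norm scaleR algebra_simps)
      ultimately show False using z(3) dz by fastforce
    qed
    then show ?thesis using z(2) p by (auto simp: m_def q_def)
  qed
  define \<epsilon> where "\<epsilon> n = 1 / real (n + 2)" for n
  have "0 < \<epsilon> n \<and> \<epsilon> n < 1" for n by (simp add: \<epsilon>_def)
  then have "\<exists>z. infdist z A = s \<and> (1 - \<epsilon> n) * dist z m \<le> q" for n using ex by blast
  then obtain z where z: "\<And>n. infdist (z n) A = s" "\<And>n. (1 - \<epsilon> n) * dist (z n) m \<le> q" by metis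
  text \<open>Since \<open>\<bar>z n - p\<bar> \<ge> s\<close> while \<open>\<bar>z n - m\<bar>\<close> is almost \<open>s - \<bar>m - p\<bar>\<close>, strict convexity
    forces \<open>z n\<close> towards the ray from \<open>p\<close> through \<open>m\<close>.\<close>
  have bound: "(dist (z n) (m + q *\<^sub>R e))\<^sup>2 \<le> s / d * ((q / (1 - \<epsilon> n))\<^sup>2 - q\<^sup>2)" for n
  proof -
    define w where "w = z n - m"
    have "1 - \<epsilon> n > 0" by (simp add: \<epsilon>_def)
    then have "norm w \<le> q / (1 - \<epsilon> n)"
      using z(2)[of n] by (simp add: w_def dist_norm field_simps)
    then have W: "(norm w)\<^sup>2 \<le> (q / (1 - \<epsilon> n))\<^sup>2" by (intro power_mono) auto
    have ee: "e \<bullet> e = 1" using p(2) by (simp add: norm_eq_1)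
    have "s \<le> norm (w + d *\<^sub>R e)"
      using infdist_le[OF p(1), of "z n"] z(1)[of n] by (simp add: w_def m_def dist_norm)
    then have "s\<^sup>2 \<le> (norm (w + d *\<^sub>R e))\<^sup>2" using s p by (intro power_mono) auto
    also have "\<dots> = (norm w)\<^sup>2 + 2 * d * (w \<bullet> e) + d\<^sup>2"
      unfolding power2_norm_eq_inner
      by (simp add: inner_simps inner_commute ee power2_eq_square algebra_simps)
    finally have 1: "s\<^sup>2 - d\<^sup>2 - (norm w)\<^sup>2 \<le> 2 * d * (w \<bullet> e)" by simp
    \<comment> \<open>Inserting the lower bound for \<open>w \<bullet> e\<close> and
      \<open>q = s - d\<close> collapses the expansion to \<open>s\<close> times the excess of the
      square of \<open>norm w\<close> over that of \<open>q\<close>, which is small.\<close>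
    have "d * (dist (z n) (m + q *\<^sub>R e))\<^sup>2 = d * (norm (w - q *\<^sub>R e))\<^sup>2"
      by (simp add: w_def dist_norm algebra_simps)
    also have "\<dots> = d * (norm w)\<^sup>2 - q * (2 * d * (w \<bullet> e)) + d * q\<^sup>2"
      unfolding power2_norm_eq_inner
      by (simp add: inner_simps inner_commute ee power2_eq_square algebra_simps)
    also have "\<dots> \<le> d * (norm w)\<^sup>2 - q * (s\<^sup>2 - d\<^sup>2 - (norm w)\<^sup>2) + d * q\<^sup>2"
      using mult_left_mono[OF 1, of q] q by linarith
    also have "\<dots> = s * ((norm w)\<^sup>2 - q\<^sup>2)"
      by (simp add: q_def power2_eq_square algebra_simps)
    also have "\<dots> \<le> s * ((q / (1 - \<epsilon> n))\<^sup>2 - q\<^sup>2)"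
      using W s p by (intro mult_left_mono) auto
    finally show ?thesis using p by (simp add: field_simps)
  qed
  have "\<epsilon> \<longlonglongrightarrow> 0"
    using LIMSEQ_ignore_initial_segment[OF lim_1_over_n[where 'a = real], of 2]
    by (simp add: \<epsilon>_def[abs_def] add.commute)
  then have "(\<lambda>n. s / d * ((q / (1 - \<epsilon> n))\<^sup>2 - q\<^sup>2)) \<longlonglongrightarrow> s / d * ((q / (1 - 0))\<^sup>2 - q\<^sup>2)"
    by (intro tendsto_intros) auto
  then have lim: "(\<lambda>n. s / d * ((q / (1 - \<epsilon> n))\<^sup>2 - q\<^sup>2)) \<longlonglongrightarrow> 0" by simp
  have "(\<lambda>n. (dist (z n) (m + q *\<^sub>R e))\<^sup>2) \<longlonglongrightarrow> 0"
    by (rule tendsto_sandwich[OF _ _ tendsto_const lim]) (use bound in \<open>auto intro!: always_eventually simp del: times_divide_eq_left\<close>)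
  then have "z \<longlonglongrightarrow> m + q *\<^sub>R e"
    by (subst tendsto_dist_iff) (simp add: power_tendsto_0_iff)
  then have "(\<lambda>n. infdist (z n) A) \<longlonglongrightarrow> infdist (m + q *\<^sub>R e) A" by (rule tendsto_infdist)
  then have "infdist (m + q *\<^sub>R e) A = s" by (simp add: z(1) LIMSEQ_const_iff)
  moreover have "m + q *\<^sub>R e = p + s *\<^sub>R e" by (simp add: m_def q_def scaleR_diff_left)
  ultimately show "s \<le> infdist (p + s *\<^sub>R e) A" by simp
qed

text \<open>The normal inequality says that the open ball of radius \<open>R\<close> that touches \<open>A\<close> at \<open>p\<close> from
  the direction \<open>e\<close> misses \<open>A\<close>.\<close>

lemma proximally_smooth_projection:
  fixes A :: "'a::{real_inner, complete_space} set"
  assumes "proximally_smooth R A" "A \<noteq> {}" "0 < infdist m A" "infdist m A < R"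
  obtains p e where "p \<in> A" "norm e = 1" "m = p + infdist m A *\<^sub>R e"
    "\<And>z. z \<in> A \<Longrightarrow> 2 * R * (e \<bullet> (z - p)) \<le> (norm (z - p))\<^sup>2"
proof -
  define d where "d = infdist m A"
  have "closed A" using assms(1) by (simp add: proximally_smooth_def)
  have diff: "(\<lambda>y. infdist y A) differentiable (at x)" if "0 < infdist x A" "infdist x A < R" for x
    using assms(1) that unfolding proximally_smooth_def differentiable_def by blast
  obtain D where D: "((\<lambda>y. infdist y A) has_derivative D) (at m)"
    using diff[OF assms(3,4)] unfolding differentiable_def by blast
  obtain e where e: "norm e = 1" "m - d *\<^sub>R e \<in> A"
    using infdist_nearest_direction[OF \<open>closed A\<close> assms(2,3) D] by (auto simp: d_def)
  define p where "p = m - d *\<^sub>R e"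
  have m: "m = p + d *\<^sub>R e" by (simp add: p_def)
  show ?thesis
  proof (rule that[OF _ e(1)])
    show "p \<in> A" using e by (simp add: p_def)
    show "m = p + infdist m A *\<^sub>R e" by (simp add: p_def d_def)
    fix z assume "z \<in> A"
    have ray: "2 * s * (e \<bullet> (z - p)) \<le> (norm (z - p))\<^sup>2" if "d < s" "s < R" for s
    proof -
      have "infdist (p + s *\<^sub>R e) A = s"
        using infdist_normal_ray[OF \<open>closed A\<close> assms(2) diff \<open>p \<in> A\<close> e(1) _ _ that] assms(3)
        by (simp add: p_def d_def)
      then have "s \<le> norm (p + s *\<^sub>R e - z)"
        using infdist_le[OF \<open>z \<in> A\<close>, of "p + s *\<^sub>R e"] by (simp add: dist_norm)
      then have "s\<^sup>2 \<le> (norm (s *\<^sub>R e - (z - p)))\<^sup>2"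
        using that assms(3) by (intro power_mono) (auto simp: d_def algebra_simps)
      also have "\<dots> = s\<^sup>2 - 2 * s * (e \<bullet> (z - p)) + (norm (z - p))\<^sup>2"
        using e(1) unfolding norm_eq_1 power2_norm_eq_inner
        by (simp add: inner_simps inner_commute power2_eq_square algebra_simps)
      finally show ?thesis by simp
    qed
    \<comment> \<open>The ray is controlled only for \<open>s < R\<close>, as the tube excludes
      distance \<open>R\<close>; the inequality survives the limit from the left.\<close>
    have "((\<lambda>s. 2 * s * (e \<bullet> (z - p))) \<longlongrightarrow> 2 * R * (e \<bullet> (z - p))) (at_left R)"
      by (intro tendsto_intros)
    moreover have "\<forall>\<^sub>F s in at_left R. 2 * s * (e \<bullet> (z - p)) \<le> (norm (z - p))\<^sup>2"
      using eventually_at_left_real[of d R] assms(4) by (auto simp: d_def elim!: eventually_mono intro!: ray)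
    ultimately show "2 * R * (e \<bullet> (z - p)) \<le> (norm (z - p))\<^sup>2"
      by (intro tendsto_upperbound[where F = "at_left R"]) auto
  qed
qed

section \<open>Approximate midpoints in a proximally smooth set\<close>

text \<open>The endpoints are \<open>m + v\<close> with \<open>v = w\<close> and
  \<open>v = - w\<close>. The ball touching \<open>A\<close> at \<open>p\<close> bounds
  \<open>e \<bullet> v\<close> from above for each, and with it the distance from \<open>p\<close>
  to that endpoint.\<close>

lemma proximally_smooth_midpoint:
  fixes A :: "'a::{real_inner, complete_space} set"
  assumes ps: "proximally_smooth R A" and "R > 0" and xy: "x \<in> A" "y \<in> A"
    and \<theta>: "0 \<le> \<theta>" "\<theta> < pi/2" and le: "dist x y \<le> 2 * R * sin \<theta>"
  shows "\<exists>p\<in>A. dist x p \<le> 2 * R * sin (\<theta>/2) \<and> dist p y \<le> 2 * R * sin (\<theta>/2)"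
proof -
  define m where "m = midpoint x y"
  define d where "d = infdist m A"
  define w where "w = (1/2) *\<^sub>R (x - y)"
  define c where "c = cos \<theta>"
  have "A \<noteq> {}" "closed A" using xy ps by (auto simp: proximally_smooth_def)
  have c: "0 < c" "c \<le> 1" using \<theta> by (auto simp: c_def intro!: cos_gt_zero_pi)
  have x: "x = m + w" and y: "y = m - w"
    by (simp_all add: m_def w_def midpoint_def algebra_simps flip: scaleR_left.add)
  have r: "norm w \<le> R * sin \<theta>" using le by (simp add: w_def dist_norm)
  then have "(norm w)\<^sup>2 \<le> (R * sin \<theta>)\<^sup>2" by (intro power_mono) auto
  then have r2: "(norm w)\<^sup>2 \<le> R\<^sup>2 * (1 - c\<^sup>2)" by (simp add: c_def power_mult_distrib sin_squared_eq)
  \<comment> \<open>By the half-angle formula, the bound in the premise is the square of the chord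
    \<open>2 * R * sin (\<theta>/2)\<close>.\<close>
  have chord: "norm u \<le> 2 * R * sin (\<theta>/2)" if "(norm u)\<^sup>2 \<le> 2 * R\<^sup>2 * (1 - c)" for u :: 'a
  proof -
    have "1 - c = 2 * (sin (\<theta>/2))\<^sup>2" using cos_double_sin[of "\<theta>/2"] by (simp add: c_def)
    then have "(norm u)\<^sup>2 \<le> (2 * R * sin (\<theta>/2))\<^sup>2" using that by (simp add: power_mult_distrib)
    moreover have "0 \<le> 2 * R * sin (\<theta>/2)" using \<theta> \<open>R > 0\<close> by (auto intro!: mult_nonneg_nonneg sin_ge_zero)
    ultimately show ?thesis by (rule power2_le_imp_le)
  qed
  show ?thesis
  proof (cases "d = 0")
    case True
    then have "m \<in> A" using \<open>A \<noteq> {}\<close> \<open>closed A\<close> by (simp add: d_def in_closed_iff_infdist_zero)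
    have "R\<^sup>2 * (1 - c\<^sup>2) = R\<^sup>2 * (1 - c) * (1 + c)" by (simp add: power2_eq_square algebra_simps)
    also have "\<dots> \<le> R\<^sup>2 * (1 - c) * 2" using c by (intro mult_left_mono) auto
    finally have "norm w \<le> 2 * R * sin (\<theta>/2)" using r2 by (intro chord) simp
    then show ?thesis using \<open>m \<in> A\<close> by (intro bexI[of _ m]) (simp_all add: x y dist_norm)
  next
    case False
    have "d \<ge> 0" by (simp add: d_def infdist_nonneg)
    with False have "d > 0" by simp
    \<comment> \<open>\<open>\<theta> < pi/2\<close> makes half the distance of \<open>x\<close> and
      \<open>y\<close> less than \<open>R\<close>, so \<open>m\<close> lies in the tube where the
      projection is available.\<close>
    have "d \<le> norm w" using infdist_le[OF xy(1), of m] by (simp add: d_def x dist_norm)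
    also have "\<dots> \<le> R * sin \<theta>" by (rule r)
    also have "\<dots> < R * 1"
      using \<theta> \<open>R > 0\<close> sin_monotone_2pi[of \<theta> "pi/2"] pi_gt_zero by (intro mult_strict_left_mono) auto
    finally have "d < R" by simp
    obtain p e where p: "p \<in> A" "norm e = 1" "m = p + d *\<^sub>R e"
      and nrm: "\<And>z. z \<in> A \<Longrightarrow> 2 * R * (e \<bullet> (z - p)) \<le> (norm (z - p))\<^sup>2"
      using proximally_smooth_projection[OF ps \<open>A \<noteq> {}\<close>, of m] \<open>d > 0\<close> \<open>d < R\<close> unfolding d_def by blast
    have key: "norm (d *\<^sub>R e + v) \<le> 2 * R * sin (\<theta>/2)" if v: "m + v \<in> A" "norm v = norm w" for v
    proof (rule chord)
      define Q where "Q = (norm (d *\<^sub>R e + v))\<^sup>2"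
      have ee: "e \<bullet> e = 1" using p(2) by (simp add: norm_eq_1)
      have Q: "Q = d\<^sup>2 + (norm w)\<^sup>2 + 2 * d * (e \<bullet> v)"
        unfolding Q_def v(2)[symmetric] power2_norm_eq_inner
        by (simp add: inner_simps inner_commute ee power2_eq_square algebra_simps)
      have "2 * R * (d + e \<bullet> v) \<le> Q"
        using nrm[OF v(1)] by (simp add: p(3) Q_def inner_simps ee)
      \<comment> \<open>Scaling by \<open>d\<close> turns the left side into the mixed term of
        \<open>Q * (R - d)\<close>, so that \<open>e \<bullet> v\<close> can be eliminated.\<close>
      then have "d * (2 * (e \<bullet> v) * (R - d)) \<le> d * (d\<^sup>2 + (norm w)\<^sup>2 - 2 * R * d)"
        using \<open>d > 0\<close> unfolding Q by (intro mult_left_mono) (auto simp: algebra_simps power2_eq_square)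
      then have "Q * (R - d) \<le> (d\<^sup>2 + (norm w)\<^sup>2) * (R - d) + d * (d\<^sup>2 + (norm w)\<^sup>2 - 2 * R * d)"
        unfolding Q by (simp add: algebra_simps)
      also have "\<dots> = R * ((norm w)\<^sup>2 - d\<^sup>2)" by (simp add: algebra_simps power2_eq_square)
      also have "\<dots> \<le> R * (R\<^sup>2 * (1 - c\<^sup>2) - d\<^sup>2)"
        using r2 \<open>R > 0\<close> by (intro mult_left_mono) auto
      \<comment> \<open>Completing the square in \<open>d\<close>: it vanishes for
        \<open>d = R * (1 - cos \<theta>)\<close>, the height of the circular arc over its
        chord.\<close>
      also have "\<dots> = 2 * R\<^sup>2 * (1 - c) * (R - d) - R * (d - R * (1 - c))\<^sup>2"
        by (simp add: algebra_simps power2_eq_square)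
      also have "\<dots> \<le> 2 * R\<^sup>2 * (1 - c) * (R - d)" using \<open>R > 0\<close> by simp
      finally show "Q \<le> 2 * R\<^sup>2 * (1 - c)" using \<open>d < R\<close> by simp
    qed
    show ?thesis
    proof (intro bexI[OF _ p(1)] conjI)
      show "dist x p \<le> 2 * R * sin (\<theta>/2)"
        using key[of w] xy(1) p(3) by (simp add: x dist_norm)
      show "dist p y \<le> 2 * R * sin (\<theta>/2)"
        using key[of "- w"] xy(2) p(3) by (simp add: y dist_norm norm_minus_commute algebra_simps)
    qed
  qed
qed

subsection \<open>Monotonicity of arcsin u / u\<close>

text \<open>The function \<open>g\<close> vanishes at 0 and at \<open>y\<close>. A negative value at
  \<open>x\<close> would make its derivative negative somewhere before \<open>x\<close> and positive
  somewhere after, although \<open>cos\<close> decreases.\<close>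

lemma sin_mult_le:
  fixes x y :: real
  assumes "0 \<le> x" "x \<le> y" "y \<le> pi/2"
  shows "x * sin y \<le> y * sin x"
proof -
  define g where "g z = y * sin z - z * sin y" for z
  have "g x \<ge> 0"
  proof (cases "y = 0 \<or> x = 0")
    case True then show ?thesis using assms by (auto simp: g_def)
  next
    case False
    then have xy: "0 < x" "0 < y" using assms by auto
    show ?thesis
    proof (cases "x = y")
      case True then show ?thesis by (simp add: g_def)
    next
      case False
      then have "x < y" using assms by simp
      have g': "(g has_real_derivative y * cos z - sin y) (at z)" for z
        unfolding g_def by (auto intro!: derivative_eq_intros)
      obtain u where u: "0 < u" "u < x" "g x - g 0 = (x - 0) * (y * cos u - sin y)"
        using MVT2[of 0 x g "\<lambda>z. y * cos z - sin y"] g' xy by blast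
      obtain v where v: "x < v" "v < y" "g y - g x = (y - x) * (y * cos v - sin y)"
        using MVT2[of x y g "\<lambda>z. y * cos z - sin y"] g' \<open>x < y\<close> by blast
      have "cos v \<le> cos u" using u v assms by (intro cos_monotone_0_pi_le) auto
      show ?thesis
      proof (rule ccontr)
        assume "\<not> 0 \<le> g x"
        moreover from this have "x * (y * cos u - sin y) < 0" "0 < (y - x) * (y * cos v - sin y)"
          using u v by (auto simp: g_def)
        then have "y * cos u < sin y" "sin y < y * cos v"
          using xy \<open>x < y\<close> by (auto simp: mult_less_0_iff zero_less_mult_iff)
        then have "y * cos u < y * cos v" by simp
        with xy have "cos u < cos v" by simp
        with \<open>cos v \<le> cos u\<close> show False by simp
      qed
    qed
  qed
  then show ?thesis by (simp add: g_def)
qed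

lemma arcsin_mult_le:
  assumes "0 \<le> u" "u \<le> v" "v \<le> 1"
  shows "arcsin u * v \<le> arcsin v * u"
proof -
  have "arcsin u * sin (arcsin v) \<le> arcsin v * sin (arcsin u)"
    using assms by (intro sin_mult_le arcsin_nonneg arcsin_le_arcsin arcsin_ubound) auto
  then show ?thesis using assms by simp
qed

lemma le_arcsin:
  assumes "0 \<le> u" "u \<le> 1"
  shows "u \<le> arcsin u"
  using sin_x_le_x[of "arcsin u"] assms by (simp add: arcsin_nonneg)

subsection \<open>Lipschitz curves in proximally smooth sets\<close>

text \<open>The parameter interval carries the length bound: bounds add under concatenation, and
  resting at the endpoint enlarges \<open>L\<close>.\<close>

definition lipschitz_connected :: "'a::metric_space set \<Rightarrow> real \<Rightarrow> 'a \<Rightarrow> 'a \<Rightarrow> bool" where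
  "lipschitz_connected A L x y \<longleftrightarrow>
     0 \<le> L \<and> (\<exists>g. 1-lipschitz_on {0..L} g \<and> g ` {0..L} \<subseteq> A \<and> g 0 = x \<and> g L = y)"

lemma lipschitz_connected_refl: "x \<in> A \<Longrightarrow> 0 \<le> L \<Longrightarrow> lipschitz_connected A L x x"
  unfolding lipschitz_connected_def
  by (intro conjI exI[of _ "\<lambda>_. x"]) (auto intro: lipschitz_onI)

lemma lipschitz_connected_trans:
  assumes "lipschitz_connected A L x y" "lipschitz_connected A M y z"
  shows "lipschitz_connected A (L + M) x z"
proof -
  obtain g where g: "0 \<le> L" "1-lipschitz_on {0..L} g" "g ` {0..L} \<subseteq> A" "g 0 = x" "g L = y"
    using assms(1) by (auto simp: lipschitz_connected_def)
  obtain h where h: "0 \<le> M" "1-lipschitz_on {0..M} h" "h ` {0..M} \<subseteq> A" "h 0 = y" "h M = z"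
    using assms(2) by (auto simp: lipschitz_connected_def)
  define k where "k s = (if s \<le> L then g s else h (s - L))" for s
  have "dist (k s) (k s') \<le> s' - s" if "s \<in> {0..L + M}" "s' \<in> {0..L + M}" "s \<le> s'" for s s'
  proof -
    consider "s' \<le> L" | "s \<le> L" "L < s'" | "L < s" using that by linarith
    then show ?thesis
    proof cases
      case 1
      then show ?thesis using lipschitz_onD[OF g(2), of s s'] that by (auto simp: k_def dist_real_def)
    next
      case 2
      have "dist (g s) (h (s' - L)) \<le> dist (g s) (g L) + dist (h 0) (h (s' - L))"
        using dist_triangle[of "g s" "h (s' - L)" y] g h by simp
      also have "\<dots> \<le> (L - s) + (s' - L)"
        using lipschitz_onD[OF g(2), of s L] lipschitz_onD[OF h(2), of 0 "s' - L"] that g(1) h(1) 2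
        by (intro add_mono) (auto simp: dist_real_def)
      finally show ?thesis using 2 by (simp add: k_def)
    next
      case 3
      then show ?thesis using lipschitz_onD[OF h(2), of "s - L" "s' - L"] that
        by (auto simp: k_def dist_real_def)
    qed
  qed
  then have "1-lipschitz_on {0..L + M} k"
    by (intro lipschitz_onI) (metis abs_of_nonneg abs_minus_commute diff_ge_0_iff_ge dist_commute
        dist_real_def linear mult_1, simp)
  moreover have "k ` {0..L + M} \<subseteq> A" using g(3) h(3) by (auto simp: k_def)
  moreover have "k 0 = x" "k (L + M) = z" using g h by (auto simp: k_def)
  ultimately show ?thesis using g(1) h(1) unfolding lipschitz_connected_def by (intro conjI exI[of _ k]) simp_all
qed

lemma floor_abs_diff_le: "\<bar>real_of_int \<lfloor>u\<rfloor> - real_of_int \<lfloor>v\<rfloor>\<bar> \<le> \<bar>u - v\<bar> + 1" for u v :: real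
  by linarith

lemma lipschitz_connected_mono:
  assumes "lipschitz_connected A L x y" "L \<le> M" "y \<in> A"
  shows "lipschitz_connected A M x y"
  using lipschitz_connected_trans[OF assms(1) lipschitz_connected_refl[OF assms(3), of "M - L"]] assms(2)
  by simp

text \<open>The curve is the uniform limit of the step functions \<open>G k\<close> through the points \<open>F k 0, \<dots>, F k (2 ^ k)\<close>
  obtained after \<open>k\<close> rounds of inserting approximate midpoints; \<open>P k\<close> relates neighbours in
  round \<open>k\<close>.\<close>

lemma lipschitz_connected_dyadic:
  fixes A :: "'a::complete_space set"
  assumes "closed A" "x \<in> A" "y \<in> A" "0 \<le> L"
    and P0: "P 0 x y"
    and P_dist: "\<And>k u v. P k u v \<Longrightarrow> dist u v \<le> L / 2 ^ k"
    and P_mid: "\<And>k u v. P k u v \<Longrightarrow> u \<in> A \<Longrightarrow> v \<in> A \<Longrightarrow> \<exists>p\<in>A. P (Suc k) u p \<and> P (Suc k) p v"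
    and P_refl: "\<And>k u. u \<in> A \<Longrightarrow> P k u u"
  shows "lipschitz_connected A L x y"
proof -
  obtain mid where mid: "\<And>k u v. P k u v \<Longrightarrow> u \<in> A \<Longrightarrow> v \<in> A \<Longrightarrow>
      mid k u v \<in> A \<and> P (Suc k) u (mid k u v) \<and> P (Suc k) (mid k u v) v"
    using P_mid by metis
  \<comment> \<open>The points are indexed by all naturals. \<open>F 0\<close> repeats
    \<open>y\<close> from index 1 on, so by \<open>P_refl\<close> neighbours are related at every
    index.\<close>
  define F where "F = rec_nat (\<lambda>j. if j = 0 then x else y)
    (\<lambda>k f j. if even j then f (j div 2) else mid k (f (j div 2)) (f (Suc (j div 2))))"
  have F0: "F 0 j = (if j = 0 then x else y)" for j by (simp add: F_def)
  have FSuc: "F (Suc k) j = (if even j then F k (j div 2) else mid k (F k (j div 2)) (F k (Suc (j div 2))))"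
    for k j by (simp add: F_def)
  have FP: "\<forall>j. F k j \<in> A \<and> P k (F k j) (F k (Suc j))" for k
  proof (induction k)
    case 0 then show ?case using assms by (auto simp: F0)
  next
    case (Suc k)
    show ?case
    proof
      fix j
      have m: "mid k (F k i) (F k (Suc i)) \<in> A \<and> P (Suc k) (F k i) (mid k (F k i) (F k (Suc i)))
        \<and> P (Suc k) (mid k (F k i) (F k (Suc i))) (F k (Suc i))" for i
        using mid Suc by blast
      show "F (Suc k) j \<in> A \<and> P (Suc k) (F (Suc k) j) (F (Suc k) (Suc j))"
        using m[of "j div 2"] Suc by (cases "even j") (auto simp: FSuc)
    qed
  qed
  have Fstep: "dist (F k i) (F k (i + j)) \<le> real j * (L / 2 ^ k)" for k i j
  proof (induction j)
    case (Suc j)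
    have "dist (F k i) (F k (i + Suc j)) \<le> dist (F k i) (F k (i + j)) + dist (F k (i + j)) (F k (Suc (i + j)))"
      using dist_triangle by simp
    also have "\<dots> \<le> real j * (L / 2 ^ k) + L / 2 ^ k"
      using Suc FP[of k] by (intro add_mono P_dist) auto
    finally show ?case by (simp add: field_simps)
  qed simp
  have Fdist: "dist (F k i) (F k j) \<le> \<bar>real j - real i\<bar> * (L / 2 ^ k)" for k i j
    using Fstep[of k i "j - i"] Fstep[of k j "i - j"] by (cases "i \<le> j") (auto simp: dist_commute of_nat_diff)
  define G where "G k s = F k (nat \<lfloor>s * 2 ^ k\<rfloor>)" for k and s :: real
  have GA: "G k s \<in> A" for k s using FP by (simp add: G_def)
  have GSuc: "dist (G k s) (G (Suc k) s) \<le> L / 2 ^ Suc k" if "0 \<le> s" for k s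
  proof -
    define i where "i = nat \<lfloor>s * 2 ^ k\<rfloor>"
    have fl: "real i \<le> s * 2 ^ k" "s * 2 ^ k < real i + 1"
      unfolding i_def using that by (auto simp: of_nat_nat)
    \<comment> \<open>Refining the grid sends index \<open>i\<close> to \<open>2 * i\<close>, the
      same point, or to \<open>2 * i + 1\<close>, the inserted midpoint; \<open>G\<close> moves by
      at most one fine step.\<close>
    have "nat \<lfloor>s * 2 ^ Suc k\<rfloor> = 2 * i \<or> nat \<lfloor>s * 2 ^ Suc k\<rfloor> = 2 * i + 1"
    proof -
      have "real (2 * i) \<le> s * 2 ^ Suc k" "s * 2 ^ Suc k < real (2 * i) + 2"
        using fl by auto
      then have "\<lfloor>s * 2 ^ Suc k\<rfloor> = int (2 * i) \<or> \<lfloor>s * 2 ^ Suc k\<rfloor> = int (2 * i) + 1" by linarith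
      then show ?thesis by auto
    qed
    then consider "nat \<lfloor>s * 2 ^ Suc k\<rfloor> = 2 * i" | "nat \<lfloor>s * 2 ^ Suc k\<rfloor> = 2 * i + 1" by blast
    then show ?thesis
    proof cases
      case 1
      then have "G (Suc k) s = G k s" unfolding G_def i_def[symmetric] by (simp only: FSuc) simp
      then show ?thesis using \<open>0 \<le> L\<close> by simp
    next
      case 2
      have "F (Suc k) (2 * i) = F k i" by (simp add: FSuc)
      then show ?thesis using Fdist[of "Suc k" "2 * i" "2 * i + 1"] unfolding G_def i_def[symmetric] 2 by simp
    qed
  qed
  have GN: "dist (G k s) (G (k + j) s) \<le> L / 2 ^ k - L / 2 ^ (k + j)" if "0 \<le> s" for k j s
  proof (induction j)
    case (Suc j)
    have "dist (G k s) (G (k + Suc j) s) \<le> dist (G k s) (G (k + j) s) + dist (G (k + j) s) (G (Suc (k + j)) s)"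
      using dist_triangle by simp
    also have "\<dots> \<le> (L / 2 ^ k - L / 2 ^ (k + j)) + L / 2 ^ Suc (k + j)"
      by (intro add_mono Suc GSuc that)
    also have "\<dots> = L / 2 ^ k - L / 2 ^ (k + Suc j)" by (simp add: field_simps)
    finally show ?case .
  qed simp
  have L0: "(\<lambda>k. L / 2 ^ k) \<longlonglongrightarrow> 0"
    using tendsto_mult[OF tendsto_const LIMSEQ_power_zero[of "1/2 :: real"], of L]
    by (simp add: power_divide)
  have "convergent (\<lambda>k. G k s)" if "0 \<le> s" for s
  proof -
    have "Cauchy (\<lambda>k. G k s)"
    proof (rule CauchyI')
      fix \<epsilon> :: real assume "\<epsilon> > 0"
      then have "\<forall>\<^sub>F k in sequentially. L / 2 ^ k < \<epsilon>" using L0 by (intro order_tendstoD(2))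
      then obtain N where N: "\<And>k. k \<ge> N \<Longrightarrow> L / 2 ^ k < \<epsilon>" by (auto simp: eventually_sequentially)
      have "dist (G m s) (G n s) < \<epsilon>" if "m \<ge> N" "n > m" for m n
      proof -
        have "0 \<le> L / 2 ^ n" using \<open>0 \<le> L\<close> by simp
        then show ?thesis using GN[OF \<open>0 \<le> s\<close>, of m "n - m"] N[OF that(1)] that(2) by simp
      qed
      then show "\<exists>M. \<forall>m\<ge>M. \<forall>n>m. dist (G m s) (G n s) < \<epsilon>" by blast
    qed
    then show ?thesis by (rule Cauchy_convergent)
  qed
  then obtain g where g: "\<And>s. 0 \<le> s \<Longrightarrow> (\<lambda>k. G k s) \<longlonglongrightarrow> g s"
    unfolding convergent_def by metis
  have gA: "g s \<in> A" if "0 \<le> s" for s using closed_sequentially[OF assms(1) GA g[OF that]] .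
  have "G k 0 = x" for k
  proof -
    have "F k 0 = x" by (induction k) (auto simp: F0 FSuc)
    then show ?thesis by (simp add: G_def)
  qed
  then have gx: "g 0 = x" using g[of 0] by (simp add: LIMSEQ_const_iff)
  have "G k 1 = y" for k
  proof -
    have "F k (2 ^ k) = y" by (induction k) (auto simp: F0 FSuc)
    moreover have "nat \<lfloor>1 * 2 ^ k :: real\<rfloor> = 2 ^ k" by (simp add: floor_power nat_power_eq)
    ultimately show ?thesis by (simp only: G_def)
  qed
  then have gy: "g 1 = y" using g[of 1] by (simp add: LIMSEQ_const_iff)
  have glip: "dist (g s) (g s') \<le> L * \<bar>s - s'\<bar>" if "0 \<le> s" "0 \<le> s'" for s s'
  proof (rule LIMSEQ_le)
    show "(\<lambda>k. dist (G k s) (G k s')) \<longlonglongrightarrow> dist (g s) (g s')"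
      by (intro tendsto_dist g that)
    have "(\<lambda>k. L * \<bar>s - s'\<bar> + L / 2 ^ k) \<longlonglongrightarrow> L * \<bar>s - s'\<bar> + 0"
      by (intro tendsto_add tendsto_const L0)
    then show "(\<lambda>k. L * \<bar>s - s'\<bar> + L / 2 ^ k) \<longlonglongrightarrow> L * \<bar>s - s'\<bar>" by simp
    \<comment> \<open>Rounding the two indices costs at most one extra grid step, of size
      \<open>L / 2 ^ k\<close>, which vanishes in the limit.\<close>
    have "dist (G k s) (G k s') \<le> L * \<bar>s - s'\<bar> + L / 2 ^ k" for k
    proof -
      have "dist (G k s) (G k s') \<le> \<bar>real (nat \<lfloor>s' * 2 ^ k\<rfloor>) - real (nat \<lfloor>s * 2 ^ k\<rfloor>)\<bar> * (L / 2 ^ k)"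
        unfolding G_def by (rule Fdist)
      also have "\<dots> = \<bar>real_of_int \<lfloor>s' * 2 ^ k\<rfloor> - real_of_int \<lfloor>s * 2 ^ k\<rfloor>\<bar> * (L / 2 ^ k)"
        using that by (simp add: of_nat_nat)
      also have "\<dots> \<le> (\<bar>s' * 2 ^ k - s * 2 ^ k\<bar> + 1) * (L / 2 ^ k)"
        using \<open>0 \<le> L\<close> by (intro mult_right_mono floor_abs_diff_le) auto
      also have "\<bar>s' * 2 ^ k - s * 2 ^ k\<bar> = \<bar>s - s'\<bar> * 2 ^ k"
        by (simp add: abs_mult abs_minus_commute flip: left_diff_distrib)
      finally show ?thesis by (simp add: field_simps)
    qed
    then show "\<exists>N. \<forall>k\<ge>N. dist (G k s) (G k s') \<le> L * \<bar>s - s'\<bar> + L / 2 ^ k" by blast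
  qed
  show ?thesis
  proof (cases "L = 0")
    case True
    then have "x = y" using P_dist[OF P0] by simp
    then show ?thesis using True lipschitz_connected_refl[OF assms(2), of 0] by simp
  next
    case False
    then have "L > 0" using \<open>0 \<le> L\<close> by simp
    have "dist (g (s / L)) (g (s' / L)) \<le> 1 * dist s s'" if "0 \<le> s" "0 \<le> s'" for s s'
      using glip[of "s / L" "s' / L"] that \<open>L > 0\<close>
      by (simp add: dist_real_def abs_divide flip: diff_divide_distrib)
    then have "1-lipschitz_on {0..L} (\<lambda>s. g (s / L))" by (intro lipschitz_onI) auto
    then show ?thesis unfolding lipschitz_connected_def
      using \<open>L > 0\<close> gA gx gy by (intro conjI exI[of _ "\<lambda>s. g (s / L)"]) auto
  qed
qed

text \<open>Each round of midpoints halves the angle in the bound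
  \<open>2 * R * sin (\<theta> / 2 ^ k)\<close>, and \<open>sin u \<le> u\<close> turns this bound
  into the share of the total length \<open>2 * R * \<theta>\<close> that the dyadic construction
  asks for.\<close>

lemma proximally_smooth_lipschitz_connected:
  fixes A :: "'a::{real_inner, complete_space} set"
  assumes ps: "proximally_smooth R A" and "R > 0" and xy: "x \<in> A" "y \<in> A"
    and lt: "dist x y < 2 * R"
  shows "lipschitz_connected A (2 * R * arcsin (dist x y / (2 * R))) x y"
proof -
  define \<theta> where "\<theta> = arcsin (dist x y / (2 * R))"
  have u: "0 \<le> dist x y / (2 * R)" "dist x y / (2 * R) < 1" using lt \<open>R > 0\<close> by auto
  have "sin \<theta> = dist x y / (2 * R)" unfolding \<theta>_def by (rule sin_arcsin) (use u in linarith)+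
  then have sin: "2 * R * sin \<theta> = dist x y" using \<open>R > 0\<close> by simp
  have \<theta>: "0 \<le> \<theta>" "\<theta> < pi/2"
    using u arcsin_lt_bounded[of "dist x y / (2 * R)"] by (auto simp: \<theta>_def arcsin_nonneg)
  have \<theta>k: "0 \<le> \<theta> / 2 ^ k" "\<theta> / 2 ^ k < pi/2" for k :: nat
    using \<theta> le_less_trans[of "\<theta> / 2 ^ k" \<theta> "pi/2"] divide_left_mono[of 1 "2 ^ k" \<theta>] by auto
  define P where "P k u v \<longleftrightarrow> dist u v \<le> 2 * R * sin (\<theta> / 2 ^ k)" for k :: nat and u v :: 'a
  show ?thesis unfolding \<theta>_def[symmetric]
  proof (rule lipschitz_connected_dyadic[of A x y _ P])
    show "closed A" using ps by (simp add: proximally_smooth_def)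
    show "P 0 x y" using sin by (simp add: P_def)
    show "0 \<le> 2 * R * \<theta>" using \<theta> \<open>R > 0\<close> by simp
    show "dist u v \<le> 2 * R * \<theta> / 2 ^ k" if "P k u v" for k u v
    proof -
      have "2 * R * sin (\<theta> / 2 ^ k) \<le> 2 * R * (\<theta> / 2 ^ k)"
        using \<open>R > 0\<close> \<theta>k by (intro mult_left_mono sin_x_le_x) auto
      then show ?thesis using that by (simp add: P_def)
    qed
    show "\<exists>p\<in>A. P (Suc k) u p \<and> P (Suc k) p v" if "P k u v" "u \<in> A" "v \<in> A" for k u v
      using proximally_smooth_midpoint[OF ps \<open>R > 0\<close> that(2,3) \<theta>k, of k] that(1)
      by (simp add: P_def mult.commute)
    have "0 \<le> sin (\<theta> / 2 ^ k)" for k :: nat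
      by (rule sin_ge_zero) (use \<theta>k[of k] pi_gt_zero in linarith)+
    then show "P k u u" for k u using \<open>R > 0\<close> by (simp add: P_def)
  qed (use xy in auto)
qed

subsection \<open>Curve length and discrete energy\<close>

lemma is_partition_mono:
  assumes "is_partition n t" "i \<le> j" "j \<le> n"
  shows "t i \<le> t j"
  using assms(2,3)
proof (induction j rule: dec_induct)
  case (step j)
  then have "t (Suc j - 1) < t (Suc j)" using assms(1) unfolding is_partition_def by (metis Suc_le_eq atLeastAtMost_iff le_add1 plus_1_eq_Suc)
  then show ?case using step by simp
qed simp

lemma is_partition_bounds:
  assumes "is_partition n t" "i \<le> n"
  shows "0 \<le> t i" "t i \<le> 1"
  using is_partition_mono[OF assms(1), of 0 i] is_partition_mono[OF assms(1), of i n] assms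
  by (auto simp: is_partition_def)

lemma is_partition_pos: "is_partition n t \<Longrightarrow> 0 < n"
  by (cases n) (auto simp: is_partition_def)

lemma is_partition_step: "is_partition n t \<Longrightarrow> i \<in> {1..n} \<Longrightarrow> 0 < t i - t (i - 1)"
  by (auto simp: is_partition_def)

lemma is_partition_sum: "is_partition n t \<Longrightarrow> (\<Sum>i=1..n. t i - t (i - 1)) = 1"
  using sum_telescope''[of 0 n t] by (simp add: is_partition_def)

lemma is_partition_trivial: "is_partition 1 of_nat"
  by (simp add: is_partition_def)

lemma curve_length_ge:
  "is_partition n t \<Longrightarrow> ennreal (\<Sum>i=1..n. norm (g (t i) - g (t (i - 1)))) \<le> curve_length g"
  unfolding curve_length_def by (rule SUP_upper2[where i = "(n, t)"]) auto

lemma curve_length_lipschitz: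
  fixes g :: "real \<Rightarrow> 'a::real_normed_vector"
  assumes "L-lipschitz_on {0..1} g"
  shows "curve_length g \<le> ennreal L"
  unfolding curve_length_def
proof (rule SUP_least, clarsimp simp del: One_nat_def)
  fix n t assume p: "is_partition n t"
  have "norm (g (t i) - g (t (i - 1))) \<le> L * (t i - t (i - 1))" if "i \<in> {1..n}" for i
    using lipschitz_onD[OF assms, of "t i" "t (i - 1)"] is_partition_bounds[OF p, of i]
      is_partition_bounds[OF p, of "i - 1"] is_partition_step[OF p that] that
    by (auto simp: dist_norm)
  then have "(\<Sum>i=1..n. norm (g (t i) - g (t (i - 1)))) \<le> (\<Sum>i=1..n. L * (t i - t (i - 1)))"
    by (rule sum_mono)
  also have "\<dots> = L" using is_partition_sum[OF p] by (simp flip: sum_distrib_left)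
  finally show "ennreal (\<Sum>i=1..n. norm (g (t i) - g (t (i - 1)))) \<le> ennreal L"
    by (rule ennreal_leI)
qed

lemma intrinsic_dist_le:
  fixes A :: "'a::real_normed_vector set"
  assumes "lipschitz_connected A L x y"
  shows "intrinsic_dist A x y \<le> ennreal L"
proof -
  obtain g where g: "0 \<le> L" "1-lipschitz_on {0..L} g" "g ` {0..L} \<subseteq> A" "g 0 = x" "g L = y"
    using assms by (auto simp: lipschitz_connected_def)
  define h where "h s = g (L * s)" for s
  have dom: "L * s \<in> {0..L}" if "s \<in> {0..1}" for s using that g(1) by (auto simp: mult_left_le)
  have lip: "L-lipschitz_on {0..1} h"
  proof (rule lipschitz_onI[OF _ g(1)])
    fix s s' :: real assume "s \<in> {0..1}" "s' \<in> {0..1}"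
    then have "dist (h s) (h s') \<le> \<bar>L * s - L * s'\<bar>"
      using lipschitz_onD[OF g(2) dom dom, of s s'] by (simp add: h_def dist_real_def)
    also have "\<dots> = L * dist s s'"
      using g(1) by (simp add: dist_real_def abs_mult flip: right_diff_distrib)
    finally show "dist (h s) (h s') \<le> L * dist s s'" .
  qed
  have "path h" unfolding path_def by (rule lipschitz_on_continuous_on[OF lip])
  moreover have "path_image h \<subseteq> A" using g(3) dom by (auto simp: path_image_def h_def)
  ultimately show ?thesis unfolding intrinsic_dist_def
    using g(4,5) curve_length_lipschitz[OF lip]
    by (intro INF_lower2[of h]) (auto simp: pathstart_def pathfinish_def h_def)
qed

text \<open>Scaling the nodes by \<open>s / s'\<close> and appending 1 turns a partition for the
  piece up to \<open>s\<close> into one for the piece up to \<open>s'\<close>, with the chord as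
  last summand. This weak form of additivity suffices for cutting the curve.\<close>

lemma curve_length_superadditive:
  fixes g :: "real \<Rightarrow> 'a::real_normed_vector"
  assumes s: "0 \<le> s" "s \<le> s'"
  shows "curve_length (\<lambda>u. g (s * u)) + ennreal (norm (g s' - g s)) \<le> curve_length (\<lambda>u. g (s' * u))"
proof -
  let ?sum = "\<lambda>n t. \<Sum>i=1..n. norm (g (s * t i) - g (s * t (i - 1)))"
  let ?N = "norm (g s' - g s)"
  have "ennreal (?sum n t) + ennreal ?N \<le> curve_length (\<lambda>u. g (s' * u))"
    if p: "is_partition n t" for n t
  proof -
    \<comment> \<open>Partitions increase strictly: for \<open>s = 0\<close> the scaled nodes would
      collapse, for \<open>s = s'\<close> the appended node would repeat the last one.\<close>
    consider "s = 0" | "s = s'" | "0 < s" "s < s'" using s by linarith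
    then show ?thesis
    proof cases
      case 1
      then show ?thesis using curve_length_ge[OF is_partition_trivial, of "\<lambda>u. g (s' * u)"] by simp
    next
      case 2
      then show ?thesis using curve_length_ge[OF p, of "\<lambda>u. g (s' * u)"] by simp
    next
      case 3
      define t' where "t' i = (if i \<le> n then s / s' * t i else 1)" for i
      have "is_partition (Suc n) t'"
        using p 3 is_partition_step[OF p] unfolding is_partition_def
        by (auto simp: t'_def divide_strict_right_mono le_Suc_eq)
      then have "ennreal (\<Sum>i=1..Suc n. norm (g (s' * t' i) - g (s' * t' (i - 1)))) \<le> curve_length (\<lambda>u. g (s' * u))"
        by (rule curve_length_ge)
      moreover have "(\<Sum>i=1..Suc n. norm (g (s' * t' i) - g (s' * t' (i - 1)))) = ?sum n t + ?N"
      proof -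
        have "norm (g (s' * t' i) - g (s' * t' (i - 1))) = norm (g (s * t i) - g (s * t (i - 1)))"
          if "i \<in> {1..n}" for i using that 3 by (auto simp: t'_def)
        moreover have "norm (g (s' * t' (Suc n)) - g (s' * t' n)) = ?N"
          using p 3 by (simp add: t'_def is_partition_def)
        ultimately show ?thesis by simp
      qed
      ultimately show ?thesis by (simp add: sum_nonneg flip: ennreal_plus)
    qed
  qed
  moreover have "(SUP (n, t) \<in> {(n, t). is_partition n t}. ennreal (?sum n t)) + ennreal ?N =
      (SUP (n, t) \<in> {(n, t). is_partition n t}. ennreal (?sum n t) + ennreal ?N)"
    by (subst ennreal_SUP_add_left[symmetric]) (use is_partition_trivial in \<open>auto simp: case_prod_unfold\<close>)
  ultimately show ?thesis
    unfolding curve_length_def[of "\<lambda>u. g (s * u)"] by (auto intro!: SUP_least)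
qed

text \<open>The curve is cut at the last parameters \<open>\<tau> c\<close> at which its length so far does not exceed
  \<open>c = L * t i\<close>. Continuity of the arc length is not needed, since the length so far is at most
  \<open>c\<close> before \<open>\<tau> c\<close> and at least \<open>c\<close> after it.\<close>

lemma curve_subdivision:
  fixes g :: "real \<Rightarrow> 'a::real_normed_vector"
  assumes "path g" "curve_length g \<le> ennreal L" "0 < L" "is_partition n t"
  obtains x where "\<And>i. i \<le> n \<Longrightarrow> x i \<in> path_image g" "x 0 = pathstart g" "x n = pathfinish g"
    "\<And>i. i \<in> {1..n} \<Longrightarrow> norm (x i - x (i - 1)) \<le> L * (t i - t (i - 1))"
proof -
  define V where "V s = curve_length (\<lambda>u. g (s * u))" for s
  have V_add: "V s + ennreal (norm (g s' - g s)) \<le> V s'" if "0 \<le> s" "s \<le> s'" for s s'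
    unfolding V_def by (rule curve_length_superadditive[OF that])
  have V_mono: "V s \<le> V s'" if "0 \<le> s" "s \<le> s'" for s s'
    by (rule order_trans[OF _ V_add[OF that]]) simp
  have V1: "V 1 \<le> ennreal L" using assms(2) by (simp add: V_def)
  have V0: "V 0 = 0"
    using curve_length_lipschitz[of 0 "\<lambda>_. g 0"] by (simp add: V_def lipschitz_on_def)
  define T where "T c = {s \<in> {0..1}. V s \<le> ennreal c}" for c
  \<comment> \<open>The value 0 for \<open>c \<le> 0\<close> gives \<open>\<tau> 0 = 0\<close> even
    if the curve rests at its start, where \<open>Sup (T 0)\<close> would be positive.\<close>
  define \<tau> where "\<tau> c = (if c \<le> 0 then 0 else Sup (T c))" for c
  have T0: "0 \<in> T c" for c by (simp add: T_def V0)
  have Tbdd: "bdd_above (T c)" for c unfolding T_def by (rule bdd_aboveI[of _ 1]) auto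
  have "0 \<le> Sup (T c)" for c by (rule cSup_upper[OF T0 Tbdd])
  moreover have "Sup (T c) \<le> 1" for c
  proof (rule cSup_least)
    show "T c \<noteq> {}" using T0 by blast
  qed (simp add: T_def)
  ultimately have \<tau>01: "0 \<le> \<tau> c" "\<tau> c \<le> 1" for c by (simp_all add: \<tau>_def)
  have after: "ennreal c \<le> V u" if "\<tau> c < u" "u \<le> 1" for c u
  proof (cases "c \<le> 0")
    case True then show ?thesis by (simp add: ennreal_neg)
  next
    case False
    then have "u \<notin> T c" using that cSup_upper[OF _ Tbdd, of u c] by (auto simp: \<tau>_def)
    moreover have "0 \<le> u" using that \<tau>01[of c] by simp
    ultimately show ?thesis using that by (auto simp: T_def)
  qed
  have before: "V u \<le> ennreal c" if "0 \<le> u" "u < \<tau> c" for c u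
  proof -
    have "u < Sup (T c)" using that by (auto simp: \<tau>_def split: if_splits)
    then obtain v where "v \<in> T c" "u < v" using less_cSup_iff[OF _ Tbdd] T0 by blast
    then show ?thesis using V_mono[of u v] that(1) by (auto simp: T_def)
  qed
  have \<tau>0: "\<tau> 0 = 0" by (simp add: \<tau>_def)
  have "1 \<in> T L" using V1 by (simp add: T_def)
  then have "1 \<le> \<tau> L" using cSup_upper[OF _ Tbdd] \<open>0 < L\<close> by (simp add: \<tau>_def)
  then have \<tau>L: "\<tau> L = 1" using \<tau>01[of L] by simp
  have close: "norm (g (\<tau> d) - g (\<tau> c)) \<le> d - c" if cd: "0 \<le> c" "c \<le> d" for c d
  proof (cases "\<tau> c < \<tau> d")
    case False
    have "\<tau> c \<le> \<tau> d"
    proof (cases "c \<le> 0")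
      case True then show ?thesis using \<tau>01[of d] by (simp add: \<tau>_def)
    next
      case False
      have "T c \<subseteq> T d" using cd by (auto simp: T_def intro: order_trans ennreal_leI)
      then show ?thesis using False cd T0 Tbdd by (auto simp: \<tau>_def intro!: cSup_subset_mono)
    qed
    then show ?thesis using False cd by simp
  next
    case True
    \<comment> \<open>Both ends of the parameter interval move inwards by \<open>h < H\<close>, to
      where \<open>after\<close> and \<open>before\<close> apply; continuity of \<open>g\<close>
      lets \<open>h\<close> tend to 0.\<close>
    define H where "H = (\<tau> d - \<tau> c) / 2"
    have "H > 0" using True by (simp add: H_def)
    define \<phi> where "\<phi> h = norm (g (\<tau> d - h) - g (\<tau> c + h))" for h
    have "\<phi> h \<le> d - c" if h: "0 < h" "h < H" for h
    proof -
      have o: "\<tau> c + h \<le> \<tau> d - h" using h by (simp add: H_def)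
      have "ennreal c + ennreal (\<phi> h) \<le> V (\<tau> c + h) + ennreal (\<phi> h)"
        using after[of c "\<tau> c + h"] h o \<tau>01[of d] by (intro add_right_mono) auto
      also have "\<dots> \<le> V (\<tau> d - h)"
        unfolding \<phi>_def using \<tau>01[of c] h o by (intro V_add) auto
      also have "\<dots> \<le> ennreal d" using before[of "\<tau> d - h" d] h o \<tau>01[of c] by simp
      finally have "ennreal (c + \<phi> h) \<le> ennreal d" using cd by (simp add: \<phi>_def)
      then show ?thesis using cd by (simp add: ennreal_le_iff)
    qed
    then have "\<forall>\<^sub>F h in at_right 0. \<phi> h \<le> d - c"
      using eventually_at_right_real[OF \<open>H > 0\<close>] by (auto elim!: eventually_mono)
    moreover have "continuous_on {0..H} \<phi>"
    proof -
      have g: "continuous_on {0..1} g" using assms(1) by (simp add: path_def)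
      have "\<tau> c + H \<le> \<tau> d" "\<tau> c + H \<le> 1" "H \<le> \<tau> d"
        using \<tau>01[of c] \<tau>01[of d] True by (simp_all add: H_def field_simps)
      then show ?thesis unfolding \<phi>_def
        using \<tau>01[of c] \<tau>01[of d]
        by (intro continuous_intros continuous_on_compose2[OF g]) auto
    qed
    then have "(\<phi> \<longlongrightarrow> \<phi> 0) (at_right 0)" by (rule continuous_on_Icc_at_rightD[OF _ \<open>H > 0\<close>])
    ultimately have "\<phi> 0 \<le> d - c" by (intro tendsto_upperbound) auto
    then show ?thesis by (simp add: \<phi>_def)
  qed
  show ?thesis
  proof (rule that[of "\<lambda>i. g (\<tau> (L * t i))"])
    show "g (\<tau> (L * t i)) \<in> path_image g" for i using \<tau>01 by (auto simp: path_image_def)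
    show "g (\<tau> (L * t 0)) = pathstart g" "g (\<tau> (L * t n)) = pathfinish g"
      using assms(4) by (simp_all add: is_partition_def \<tau>0 \<tau>L pathstart_def pathfinish_def)
    fix i assume i: "i \<in> {1..n}"
    then show "norm (g (\<tau> (L * t i)) - g (\<tau> (L * t (i - 1)))) \<le> L * (t i - t (i - 1))"
      using close[of "L * t (i - 1)" "L * t i"] is_partition_bounds[OF assms(4), of "i - 1"]
        is_partition_step[OF assms(4) i] \<open>0 < L\<close>
      by (auto simp: algebra_simps)
  qed
qed

section \<open>Comparison of discrete energy and intrinsic distance\<close>

text \<open>Chords of length at most \<open>L * (t i - t (i - 1))\<close> have total energy at most
  the square of \<open>L\<close>, as the steps of \<open>t\<close> sum to 1. The slack \<epsilon>
  allows for an infimum that is not attained and makes \<open>L\<close> positive.\<close>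

lemma discrete_energy_le_intrinsic_dist:
  fixes A :: "'a::real_normed_vector set"
  assumes p: "is_partition n t"
  shows "discrete_energy A a b n t \<le> (intrinsic_dist A a b)\<^sup>2"
proof (cases "intrinsic_dist A a b")
  case top
  then show ?thesis by (simp add: power2_eq_square ennreal_top_mult)
next
  case (real r)
  have le: "discrete_energy A a b n t \<le> ennreal ((r + \<epsilon>)\<^sup>2)" if "\<epsilon> > 0" for \<epsilon>
  proof -
    define L where "L = r + \<epsilon>"
    have "L > 0" using that real by (simp add: L_def)
    have "intrinsic_dist A a b < ennreal L" using that real by (simp add: L_def ennreal_less_iff)
    then obtain g where g: "path g" "path_image g \<subseteq> A" "pathstart g = a" "pathfinish g = b"
      "curve_length g < ennreal L"
      unfolding intrinsic_dist_def INF_less_iff by auto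
    obtain x where x: "\<And>i. i \<le> n \<Longrightarrow> x i \<in> path_image g" "x 0 = a" "x n = b"
      "\<And>i. i \<in> {1..n} \<Longrightarrow> norm (x i - x (i - 1)) \<le> L * (t i - t (i - 1))"
      using curve_subdivision[OF g(1) less_imp_le[OF g(5)] \<open>L > 0\<close> p] g(3,4) by metis
    have "(norm (x i - x (i - 1)))\<^sup>2 / (t i - t (i - 1)) \<le> L\<^sup>2 * (t i - t (i - 1))" if i: "i \<in> {1..n}" for i
    proof -
      have "(norm (x i - x (i - 1)))\<^sup>2 \<le> (L * (t i - t (i - 1)))\<^sup>2"
        using x(4)[OF i] by (rule power_mono) simp
      then show ?thesis using is_partition_step[OF p i] by (simp add: divide_le_eq power2_eq_square mult_ac)
    qed
    then have "(\<Sum>i=1..n. (norm (x i - x (i - 1)))\<^sup>2 / (t i - t (i - 1))) \<le> (\<Sum>i=1..n. L\<^sup>2 * (t i - t (i - 1)))"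
      by (rule sum_mono)
    also have "\<dots> = L\<^sup>2" using is_partition_sum[OF p] by (simp flip: sum_distrib_left)
    finally show ?thesis unfolding discrete_energy_def L_def[symmetric]
      using x(1-3) g(2) by (intro INF_lower2[of x] ennreal_leI) auto
  qed
  have "((\<lambda>\<epsilon>. ennreal ((r + \<epsilon>)\<^sup>2)) \<longlongrightarrow> ennreal ((r + 0)\<^sup>2)) (at_right 0)"
    by (intro tendsto_ennrealI tendsto_intros)
  moreover have "\<forall>\<^sub>F \<epsilon> in at_right 0. discrete_energy A a b n t \<le> ennreal ((r + \<epsilon>)\<^sup>2)"
    using eventually_at_right_less[of "0::real"] by (rule eventually_mono) (rule le)
  ultimately have "discrete_energy A a b n t \<le> ennreal ((r + 0)\<^sup>2)"
    by (intro tendsto_lowerbound[where F = "at_right (0::real)"]) auto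
  then show ?thesis using real by (simp add: ennreal_power)
qed

text \<open>Cauchy-Schwarz for \<open>?l i / sqrt (?d i)\<close> and \<open>sqrt (?d i)\<close>,
  where the squares of the latter sum to 1.\<close>

lemma polygon_energy_ge:
  fixes x :: "nat \<Rightarrow> 'a::real_normed_vector"
  assumes p: "is_partition n t"
  shows "(\<Sum>i=1..n. norm (x i - x (i - 1)))\<^sup>2 \<le> (\<Sum>i=1..n. (norm (x i - x (i - 1)))\<^sup>2 / (t i - t (i - 1)))"
proof -
  let ?d = "\<lambda>i. t i - t (i - 1)" and ?l = "\<lambda>i. norm (x i - x (i - 1))"
  have d: "?l i / sqrt (?d i) * sqrt (?d i) = ?l i" "(sqrt (?d i))\<^sup>2 = ?d i" if "i \<in> {1..n}" for i
    using is_partition_step[OF p that] by simp_all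
  have "(\<Sum>i=1..n. ?l i) = (\<Sum>i=1..n. ?l i / sqrt (?d i) * sqrt (?d i))"
    by (rule sum.cong[OF refl d(1)[symmetric]])
  then have "(\<Sum>i=1..n. ?l i)\<^sup>2 \<le> (\<Sum>i=1..n. (?l i / sqrt (?d i))\<^sup>2) * (\<Sum>i=1..n. (sqrt (?d i))\<^sup>2)"
    by (simp only: Cauchy_Schwarz_ineq_sum)
  also have "\<dots> = (\<Sum>i=1..n. (?l i)\<^sup>2 / ?d i) * (\<Sum>i=1..n. ?d i)"
    by (intro arg_cong2[where f = "(*)"] sum.cong refl) (simp_all only: power_divide d(2))
  also have "(\<Sum>i=1..n. ?d i) = 1" by (rule is_partition_sum[OF p])
  finally show ?thesis by simp
qed

text \<open>A single sequence of points is treated here, so that the infimum is taken only at the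
  end. The sign facts serve the final computation in \<open>ennreal\<close>.\<close>

lemma intrinsic_dist_le_polygon_energy:
  fixes A :: "'a::{real_inner, complete_space} set"
  assumes "R > 0" and ps: "proximally_smooth R A" and ab: "a \<in> A" "b \<in> A" "norm (a - b) < 2 * R"
    and p: "is_partition n t" and small: "pi / 2 * sqrt (mesh n t) \<le> 1"
    and x: "\<And>i. i \<le> n \<Longrightarrow> x i \<in> A" "x 0 = a" "x n = b"
    and E: "E = (\<Sum>i=1..n. (norm (x i - x (i - 1)))\<^sup>2 / (t i - t (i - 1)))"
  shows "intrinsic_dist A a b \<le> ennreal (mesh_const n t * sqrt E)" "0 < mesh_const n t" "0 \<le> E"
proof -
  define v where "v = pi / 2 * sqrt (mesh n t)"
  define k where "k = mesh_const n t"
  have mesh: "t i - t (i - 1) \<le> mesh n t" if "i \<in> {1..n}" for i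
    unfolding mesh_def using that by (intro Max_ge) auto
  have "1 \<in> {1..n}" using is_partition_pos[OF p] by simp
  then have mpos: "0 < mesh n t" using mesh is_partition_step[OF p] by (blast intro: less_le_trans)
  then have v: "0 < v" "v \<le> 1" using small by (auto simp: v_def)
  have k: "k = arcsin v / v" by (simp add: k_def v_def mesh_const_def)
  have "1 \<le> k" using le_arcsin[of v] v by (simp add: k)
  then show "0 < mesh_const n t" by (simp add: k_def)
  have terms: "0 \<le> (norm (x i - x (i - 1)))\<^sup>2 / (t i - t (i - 1))" if "i \<in> {1..n}" for i
    using is_partition_step[OF p that] by simp
  then show "0 \<le> E" unfolding E by (rule sum_nonneg)
  show "intrinsic_dist A a b \<le> ennreal (mesh_const n t * sqrt E)"
  proof (cases "sqrt E < pi * R")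
    case False
    have "0 \<le> dist a b / (2 * R)" "dist a b / (2 * R) \<le> 1" using ab \<open>R > 0\<close> by (auto simp: dist_norm)
    then have "arcsin (dist a b / (2 * R)) \<le> pi / 2" by (intro arcsin_ubound) linarith+
    then have "2 * R * arcsin (dist a b / (2 * R)) \<le> 2 * R * (pi / 2)"
      using \<open>R > 0\<close> by (intro mult_left_mono) auto
    also have "\<dots> \<le> sqrt E" using False by (simp add: mult.commute)
    also have "\<dots> \<le> k * sqrt E" using \<open>1 \<le> k\<close> \<open>0 \<le> E\<close> by (simp add: mult_le_cancel_right1)
    finally have "2 * R * arcsin (dist a b / (2 * R)) \<le> mesh_const n t * sqrt E" by (simp add: k_def)
    moreover have "lipschitz_connected A (2 * R * arcsin (dist a b / (2 * R))) a b"
      using ab by (intro proximally_smooth_lipschitz_connected[OF ps \<open>R > 0\<close>]) (simp_all add: dist_norm)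
    ultimately show ?thesis using intrinsic_dist_le lipschitz_connected_mono ab(2) by blast
  next
    case True
    have seg: "lipschitz_connected A (k * norm (x i - x (i - 1))) (x (i - 1)) (x i)"
      if i: "i \<in> {1..n}" for i
    proof -
      define l where "l = norm (x i - x (i - 1))"
      have l: "dist (x (i - 1)) (x i) = l" "0 \<le> l" by (simp_all add: l_def dist_norm norm_minus_commute)
      \<comment> \<open>One summand is at most \<open>E\<close> and its time step at most the mesh.
        Together with \<open>sqrt E < pi * R\<close> this yields \<open>2 * R * v\<close>, the
        origin of the argument of \<open>arcsin\<close> in \<open>mesh_const\<close>.\<close>
      have "l\<^sup>2 / (t i - t (i - 1)) \<le> E"
        unfolding E l_def using i terms by (intro member_le_sum) auto
      then have "l\<^sup>2 \<le> E * (t i - t (i - 1))" using is_partition_step[OF p i] by (simp add: divide_le_eq)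
      also have "\<dots> \<le> E * mesh n t" using \<open>0 \<le> E\<close> mesh[OF i] by (intro mult_left_mono)
      finally have "l \<le> sqrt (E * mesh n t)" by (rule real_le_rsqrt)
      also have "\<dots> < (pi * R) * sqrt (mesh n t)" using True mpos by (simp add: real_sqrt_mult)
      also have "\<dots> = 2 * R * v" by (simp add: v_def)
      finally have lt: "l < 2 * R * v" .
      also have "\<dots> \<le> 2 * R" using v \<open>R > 0\<close> by simp
      finally have "l < 2 * R" .
      have "arcsin (l / (2 * R)) * v \<le> arcsin v * (l / (2 * R))"
        using lt l \<open>R > 0\<close> v by (intro arcsin_mult_le) (auto simp: divide_le_eq mult.commute)
      then have "2 * R * arcsin (l / (2 * R)) \<le> k * l"
        using v \<open>R > 0\<close> by (simp add: k field_simps)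
      moreover have "x (i - 1) \<in> A" "x i \<in> A" using x(1) i by auto
      moreover have "lipschitz_connected A (2 * R * arcsin (l / (2 * R))) (x (i - 1)) (x i)"
        using proximally_smooth_lipschitz_connected[OF ps \<open>R > 0\<close> \<open>x (i - 1) \<in> A\<close> \<open>x i \<in> A\<close>] \<open>l < 2 * R\<close>
        unfolding l(1) by blast
      ultimately show ?thesis unfolding l_def[symmetric] by (blast intro: lipschitz_connected_mono)
    qed
    have "lipschitz_connected A (\<Sum>i=1..j. k * norm (x i - x (i - 1))) (x 0) (x j)" if "j \<le> n" for j
      using that
    proof (induction j)
      case 0 then show ?case using x(1) by (simp add: lipschitz_connected_refl)
    next
      case (Suc j)
      have "lipschitz_connected A (k * norm (x (Suc j) - x j)) (x j) (x (Suc j))"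
        using seg[of "Suc j"] Suc.prems by simp
      then show ?case using lipschitz_connected_trans Suc by fastforce
    qed
    from this[of n] have "intrinsic_dist A a b \<le> ennreal (k * (\<Sum>i=1..n. norm (x i - x (i - 1))))"
      using x(2,3) by (intro intrinsic_dist_le) (simp add: sum_distrib_left)
    also have "\<dots> \<le> ennreal (k * sqrt E)"
    proof (intro ennreal_leI mult_left_mono)
      show "(\<Sum>i=1..n. norm (x i - x (i - 1))) \<le> sqrt E"
        unfolding E by (intro real_le_rsqrt polygon_energy_ge p)
    qed (use \<open>1 \<le> k\<close> in simp)
    finally show ?thesis by (simp add: k_def)
  qed
qed

theorem theorem6p4:
  fixes A :: "'a::{real_inner, complete_space} set"
    and a b :: 'a and R :: real and n :: nat and t :: "nat \<Rightarrow> real"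
  assumes "\<exists>u v :: 'a. u \<noteq> v \<and> independent {u, v}"
    and "R > 0"
    and "proximally_smooth R A"
    and "a \<in> A" and "b \<in> A" and "a \<noteq> b"
    and "norm (a - b) < 2 * R"
    and "is_partition n t"
  shows "(intrinsic_dist A a b)\<^sup>2 \<ge> discrete_energy A a b n t \<and>
         (pi / 2 * sqrt (mesh n t) \<le> 1 \<longrightarrow>
            discrete_energy A a b n t \<ge>
              (intrinsic_dist A a b)\<^sup>2 / ennreal ((mesh_const n t)\<^sup>2))"
proof (intro conjI impI)
  show "discrete_energy A a b n t \<le> (intrinsic_dist A a b)\<^sup>2"
    by (rule discrete_energy_le_intrinsic_dist[OF assms(8)])
  assume small: "pi / 2 * sqrt (mesh n t) \<le> 1"
  show "(intrinsic_dist A a b)\<^sup>2 / ennreal ((mesh_const n t)\<^sup>2) \<le> discrete_energy A a b n t"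
    unfolding discrete_energy_def
  proof (rule INF_greatest)
    fix x assume "x \<in> {x. (\<forall>i\<le>n. x i \<in> A) \<and> x 0 = a \<and> x n = b}"
    then have x: "\<And>i. i \<le> n \<Longrightarrow> x i \<in> A" "x 0 = a" "x n = b" by auto
    define E where "E = (\<Sum>i=1..n. (norm (x i - x (i - 1)))\<^sup>2 / (t i - t (i - 1)))"
    note bound = intrinsic_dist_le_polygon_energy[OF assms(2-5,7,8) small x E_def]
    have "(intrinsic_dist A a b)\<^sup>2 \<le> (ennreal (mesh_const n t * sqrt E))\<^sup>2"
      using bound(1) by (intro power_mono) auto
    also have "\<dots> = ennreal ((mesh_const n t)\<^sup>2) * ennreal E"
      using bound(2,3) by (simp add: ennreal_power power_mult_distrib ennreal_mult less_imp_le)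
    finally have "(intrinsic_dist A a b)\<^sup>2 \<le> ennreal ((mesh_const n t)\<^sup>2) * ennreal E" .
    moreover have "0 < ennreal ((mesh_const n t)\<^sup>2)" using bound(2) by simp
    ultimately show "(intrinsic_dist A a b)\<^sup>2 / ennreal ((mesh_const n t)\<^sup>2) \<le>
        ennreal (\<Sum>i=1..n. (norm (x i - x (i - 1)))\<^sup>2 / (t i - t (i - 1)))"
      unfolding E_def by (intro divide_le_posI_ennreal)
  qed
qed

end
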